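(* (Blended boundary condition.) Consider the UGKS with the left boundary value and left macroscopic boundary flux $$\rho^n_{1/2}=2\bigl\langle[(1-\theta(\nu_{1/2}))v+\theta(\nu_{1/2})W]f_L\mathbf 1_{v>0}\bigr\rangle,$$ $$\Phi_{1/2}=\frac1\varepsilon\bigl\langle[(1-\theta(\nu_{1/2}))v+\theta(\nu_{1/2})\times(-2\langle v\mathbf 1_{v<0}\rangle)W]f_L\mathbf 1_{v>0}\bigr\rangle+A_{1/2}\langle vf_1^n\mathbf 1_{v<0}\rangle+\langle v\mathbf 1_{v<0}\rangle C_{1/2}\rho^n_{1/2}+\langle v^2\mathbf 1_{v<0}\rangle D_{1/2}\,\delta_x\rho^{nR}_{1/2}+\langle v\mathbf 1_{v<0}\rangle E_{1/2}G,$$ the same $\rho^n_{1/2}$ being used in the left microscopic boundary flux $\phi_{1/2}$, with blending parameter $\theta(\nu)=1-\exp(-\nu\Delta t)$, which tends to $1$ for small $\varepsilon$ and to $0$ for small $\sigma$ and $\alpha$. This definition implies that: (a) in the diffusion limit ($\varepsilon\to0$), one gets the correct Dirichlet boundary condition $2\langle Wf_L\mathbf 1_{v>0}\rangle$; (b) in the free transport regime ($\sigma,\alpha\to0$ with $\varepsilon$ constant), the microscopic and macroscopic boundary fluxes $\phi_{1/2}$ and $\Phi_{1/2}$ tend to the correct values, namely the first-order upwind boundary fluxes $$\frac v\varepsilon\bigl(f_L\mathbf 1_{v>0}+f_1^n\mathbf 1_{v<0}\bigr)\qquad\text{and}\qquad\frac1\varepsilon\bigl\langle vf_L\mathbf 1_{v>0}+vf_1^n\mathbf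 1_{v<0}\bigr\rangle,$$ respectively.
   Context: The average of a function $\phi$ of $v\in[-1,1]$ is $\langle\phi\rangle=\frac12\int_{-1}^1\phi(v)\,dv$; $\mathbf 1_{v>0},\mathbf 1_{v<0}$ are indicator functions. The unified gas kinetic scheme (UGKS) approximates the linear kinetic equation $\varepsilon\partial_tf+v\partial_xf=\frac{\sigma}{\varepsilon}(\langle f\rangle-f)-\varepsilon\alpha f+\varepsilon G$ for $x\in[0,1]$, with boundary data $f(t,0,v)=f_L(v)$ for $v>0$, where $f_L$ may depend on $v$ (non isotropic data); $\sigma,\alpha,G$ may depend on $x$ but not on $v$. The diffusion limit as $\varepsilon\to0$ is $\partial_t\rho-\partial_x(\frac{1}{3\sigma}\partial_x\rho)=-\alpha\rho+G$. For non isotropic data, $f$ is well approximated by the solution $\rho$ of the diffusion equation outside the boundary layer only if this equation is supplemented by the boundary condition $\rho(t,0)=\int_0^1W(v)f_L(v)\,dv=2\langle Wf_L\mathbf 1_{v>0}\rangle$, where $W$ is the special function of boundary layer theory that is well approximated by $0.956v+1.565v^2\approx\frac32v^2+v$; this is the "correct" Dirichlet value. The grid has space step $\Delta x$ and time step $\Delta t$, with first cell $[x_{1/2},x_{3/2}]$, $x_{1/2}=0$; $f_1^n(v)$ is the approximation of the average of $f(t_n,\cdot,v)$ over the first cell, $\rho_1^n=\langle f_1^n\rangle$, and the subscript $1/2$ denotes values at the left boundary. The macroscopic flux $\Phi_{1/2}$ enters the discrete conservation law of the first cell, $\frac{\rho_1^{n+1}-\rho_1^n}{\Delta t}+\frac1{\Delta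 x}(\Phi_{3/2}-\Phi_{1/2})=-\alpha_1\rho_1^{n+1}+G$ (with $\alpha_1$ the value of $\alpha$ in the first cell and $\Phi_{3/2}$ the macroscopic flux at the interior interface $x_{3/2}$), and $\phi_{1/2}$ enters the corresponding relation for $f_1^{n+1}$. The right slope at the left boundary is $\delta_x\rho^{nR}_{1/2}=\frac{\rho_1^n-\rho^n_{1/2}}{\Delta x/2}$ and the left microscopic boundary flux is $$\phi_{1/2}=\frac v\varepsilon f_L\mathbf 1_{v>0}+A_{1/2}vf_1^n\mathbf 1_{v<0}+C_{1/2}v\rho^n_{1/2}\mathbf 1_{v<0}+D_{1/2}v^2\delta_x\rho^{nR}_{1/2}\mathbf 1_{v<0}+E_{1/2}vG\mathbf 1_{v<0}.$$ With $\nu=\frac{\sigma}{\varepsilon^2}+\alpha$, $A=\frac{1}{\Delta t\varepsilon\nu}(1-e^{-\nu\Delta t})$, $C=\frac{\sigma}{\Delta t\varepsilon^3\nu}\bigl(\Delta t-\frac1\nu(1-e^{-\nu\Delta t})\bigr)$, $D=-\frac{\sigma}{\Delta t\varepsilon^4\nu^2}\bigl(\Delta t(1+e^{-\nu\Delta t})-\frac2\nu(1-e^{-\nu\Delta t})\bigr)$, $E=\frac{1}{\Delta t\varepsilon\nu}\bigl(\Delta t-\frac1\nu(1-e^{-\nu\Delta t})\bigr)$; the subscript $1/2$ on $\nu,A,C,D,E$ means evaluation at $(\sigma,\alpha)=(\sigma_{1/2},\alpha_{1/2})$.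
   Formalization: In (b) it is additionally assumed that the source G tends to 0 together with σ and α (G = 0 included); for fixed G ≠ 0 the term E_{1/2} v G 1_{v<0} tends to (Δt/2ε) v G 1_{v<0}, so the stated upwind limits fail. *)

theory Defs
  imports "HOL-Analysis.Analysis"
begin

definition avg :: "(real \<Rightarrow> real) \<Rightarrow> real" where
  "avg \<phi> = (1/2) * (LINT v:{-1..1}|lborel. \<phi> v)"

abbreviation pos :: "real \<Rightarrow> real" where
  "pos v \<equiv> indicator {0<..} v"

abbreviation neg :: "real \<Rightarrow> real" where
  "neg v \<equiv> indicator {..<0} v"

text \<open>Convergence of a parametrised family of velocity distributions in the mean over
  \<open>[-1,1]\<close>.  The integrability clauses are needed because the average of a non-integrable
  function is \<open>0\<close> by convention.\<close>

definition converges_in_mean ::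
  "'p filter \<Rightarrow> ('p \<Rightarrow> real \<Rightarrow> real) \<Rightarrow> (real \<Rightarrow> real) \<Rightarrow> bool" where
  "converges_in_mean F f g \<longleftrightarrow>
     set_integrable lborel {-1..1} g \<and>
     (\<forall>\<^sub>F p in F. set_integrable lborel {-1..1} (f p)) \<and>
     ((\<lambda>p. avg (\<lambda>v. \<bar>f p v - g v\<bar>)) \<longlongrightarrow> 0) F"

text \<open>In all coefficients, \<open>dt\<close> is the time step, \<open>e\<close> is \<open>\<epsilon>\<close>, and \<open>s\<close>, \<open>a\<close> are the values of
  \<open>\<sigma>\<close> and \<open>\<alpha>\<close> at the boundary.  They are meaningful only for \<open>e > 0\<close> and \<open>ugks_nu e s a \<noteq> 0\<close>.\<close>

definition ugks_nu :: "real \<Rightarrow> real \<Rightarrow> real \<Rightarrow> real" where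
  "ugks_nu e s a = s / e\<^sup>2 + a"

definition ugks_A :: "real \<Rightarrow> real \<Rightarrow> real \<Rightarrow> real \<Rightarrow> real" where
  "ugks_A dt e s a =
     (let nu = ugks_nu e s a in 1 / (dt * e * nu) * (1 - exp (- nu * dt)))"

definition ugks_C :: "real \<Rightarrow> real \<Rightarrow> real \<Rightarrow> real \<Rightarrow> real" where
  "ugks_C dt e s a =
     (let nu = ugks_nu e s a in
        s / (dt * e ^ 3 * nu) * (dt - 1 / nu * (1 - exp (- nu * dt))))"

definition ugks_D :: "real \<Rightarrow> real \<Rightarrow> real \<Rightarrow> real \<Rightarrow> real" where
  "ugks_D dt e s a =
     (let nu = ugks_nu e s a in
        - (s / (dt * e ^ 4 * nu\<^sup>2)
            * (dt * (1 + exp (- nu * dt)) - 2 / nu * (1 - exp (- nu * dt)))))"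

definition ugks_E :: "real \<Rightarrow> real \<Rightarrow> real \<Rightarrow> real \<Rightarrow> real" where
  "ugks_E dt e s a =
     (let nu = ugks_nu e s a in
        1 / (dt * e * nu) * (dt - 1 / nu * (1 - exp (- nu * dt))))"

definition theta :: "real \<Rightarrow> real \<Rightarrow> real" where
  "theta dt nu = 1 - exp (- nu * dt)"

definition dirichlet_value :: "(real \<Rightarrow> real) \<Rightarrow> (real \<Rightarrow> real) \<Rightarrow> real" where
  "dirichlet_value W fL = 2 * avg (\<lambda>v. W v * fL v * pos v)"

definition rho_left ::
  "(real \<Rightarrow> real) \<Rightarrow> (real \<Rightarrow> real) \<Rightarrow> real \<Rightarrow> real \<Rightarrow> real \<Rightarrow> real \<Rightarrow> real" where
  "rho_left W fL dt e s a =
     (let th = theta dt (ugks_nu e s a) in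
        2 * avg (\<lambda>v. ((1 - th) * v + th * W v) * fL v * pos v))"

definition right_slope :: "real \<Rightarrow> real \<Rightarrow> real \<Rightarrow> real" where
  "right_slope dx rho1 rhob = (rho1 - rhob) / (dx / 2)"

definition micro_flux_left ::
  "(real \<Rightarrow> real) \<Rightarrow> (real \<Rightarrow> real) \<Rightarrow> real \<Rightarrow> real \<Rightarrow> real \<Rightarrow> real \<Rightarrow> real \<Rightarrow> real
     \<Rightarrow> (real \<Rightarrow> real) \<Rightarrow> real \<Rightarrow> real" where
  "micro_flux_left W fL dt dx e s a G f1 v =
     (let rhob = rho_left W fL dt e s a in
        v / e * fL v * pos v
      + ugks_A dt e s a * v * f1 v * neg v
      + ugks_C dt e s a * v * rhob * neg v
      + ugks_D dt e s a * v\<^sup>2 * right_slope dx (avg f1) rhob * neg v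
      + ugks_E dt e s a * v * G * neg v)"

definition macro_flux_left ::
  "(real \<Rightarrow> real) \<Rightarrow> (real \<Rightarrow> real) \<Rightarrow> real \<Rightarrow> real \<Rightarrow> real \<Rightarrow> real \<Rightarrow> real \<Rightarrow> real
     \<Rightarrow> (real \<Rightarrow> real) \<Rightarrow> real" where
  "macro_flux_left W fL dt dx e s a G f1 =
     (let th = theta dt (ugks_nu e s a); rhob = rho_left W fL dt e s a in
        1 / e * avg (\<lambda>v. ((1 - th) * v + th * (- 2 * avg (\<lambda>w. w * neg w)) * W v) * fL v * pos v)
      + ugks_A dt e s a * avg (\<lambda>v. v * f1 v * neg v)
      + avg (\<lambda>v. v * neg v) * ugks_C dt e s a * rhob
      + avg (\<lambda>v. v\<^sup>2 * neg v) * ugks_D dt e s a * right_slope dx (avg f1) rhob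
      + avg (\<lambda>v. v * neg v) * ugks_E dt e s a * G)"

text \<open>Discrete conservation law of the first cell: \<open>r\<close> and \<open>r'\<close> are the densities at the old and
  new time level, \<open>\<Phi>l\<close> and \<open>\<Phi>r\<close> the fluxes through the boundary and the first interior
  interface, and \<open>a1\<close>, \<open>G1\<close> the values of \<open>\<alpha>\<close> and \<open>G\<close> in the cell.\<close>

definition first_cell_law ::
  "real \<Rightarrow> real \<Rightarrow> real \<Rightarrow> real \<Rightarrow> real \<Rightarrow> real \<Rightarrow> real \<Rightarrow> real \<Rightarrow> bool" where
  "first_cell_law dt dx a1 G1 r r' \<Phi>l \<Phi>r \<longleftrightarrow>
     (r' - r) / dt + 1 / dx * (\<Phi>r - \<Phi>l) = - a1 * r' + G1"

end

theory Submission
  imports Defs "HOL-Real_Asymp.Real_Asymp"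
begin

text \<open>Averages are linear, so the boundary data enter only through the two numbers
  \<open>J = \<langle>v fL pos v\<rangle>\<close> and \<open>K = 2 \<langle>W fL pos v\<rangle>\<close> (the correct Dirichlet value).  Since
  \<open>\<langle>v neg v\<rangle> = -1/4\<close> and \<open>\<langle>v\<^sup>2 neg v\<rangle> = 1/6\<close>, the boundary value is \<open>(1-\<theta>) 2J + \<theta> K\<close> and the macroscopic
  flux is (\<open>macro_flux_left_eq\<close>)
  \<open>(1-\<theta>)(1/\<epsilon> - C/2) J + \<theta> (1/\<epsilon> - C) K/4 + A \<langle>v f1 neg v\<rangle> + (D/6) \<delta> - (E/4) G\<close>,
  where \<open>\<delta>\<close> is the right slope.  The theorem is then a statement about the scalar coefficients.

  In the diffusion limit \<open>1/\<epsilon>\<close> and \<open>C\<close> both blow up, and the scheme survives because the weight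
  \<open>-2 \<langle>v neg v\<rangle> = 1/2\<close> given to \<open>W\<close> in the flux makes them appear as the difference \<open>1/\<epsilon> - C\<close>,
  which is of order \<open>\<epsilon>\<close> (\<open>C_gap_diffusion\<close>): the incoming half flux of \<open>K\<close> balances the outgoing
  half flux of the Maxwellian \<open>K\<close>.  The \<open>J\<close> part has no such balance, but there \<open>1-\<theta> = exp (-\<nu> \<Delta>t)\<close>
  with \<open>\<nu>\<close> of order \<open>1/\<epsilon>\<^sup>2\<close> beats the factor \<open>1/\<epsilon>\<close>.  What remains is the slope term, and
  \<open>D \<longlongrightarrow> -1/\<sigma>\<close> turns it into the half-cell diffusion flux with Dirichlet value \<open>K\<close>.  The law of
  the first cell can be solved for the new density, so that density converges as well.

  In the free transport regime \<open>\<nu>\<close> tends to \<open>0\<close> from the right.  The coefficients are ratios of the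
  form \<open>0/0\<close> in \<open>\<nu>\<close> whose Taylor expansions give finite limits; \<open>C\<close> and \<open>D\<close> carry an additional
  factor \<open>\<sigma> \<longlongrightarrow> 0\<close>, and \<open>E\<close> is multiplied by \<open>G \<longlongrightarrow> 0\<close>, so that only \<open>A \<longlongrightarrow> 1/\<epsilon>\<close> and the
  \<open>J\<close> part of the incoming flux survive.\<close>

section \<open>Half-range averages\<close>

lemma avg_indicator_Ioc:
  fixes h :: "real \<Rightarrow> real"
  shows "avg (\<lambda>v. h v * pos v) = (LINT v:{0<..1}|lborel. h v) / 2"
proof -
  have "(LINT v:{-1..1}|lborel. h v * pos v) = (LINT v:{0<..1}|lborel. h v)"
    unfolding set_lebesgue_integral_def
    by (rule Bochner_Integration.integral_cong) (auto simp: indicator_def)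
  thus ?thesis by (simp add: avg_def)
qed

lemma set_integrable_pos:
  fixes h :: "real \<Rightarrow> real"
  assumes "set_integrable lborel {0<..1} h"
  shows "set_integrable lborel {-1..1} (\<lambda>v. h v * pos v)"
proof -
  have "(\<lambda>v. indicator {-1..1} v *\<^sub>R (h v * pos v)) = (\<lambda>v. indicator {0<..1} v *\<^sub>R h v)"
    by (auto simp: indicator_def)
  thus ?thesis using assms by (simp add: set_integrable_def)
qed

lemma integral_power_neg:
  "(LINT v:{-1..1}|lborel. v ^ n * neg v) = - ((-1) ^ Suc n) / real (Suc n)"
proof -
  have "(LINT v:{-1..1}|lborel. v ^ n * neg v) = (\<integral>v. v ^ n * indicator {-1..0} v \<partial>lborel)"
    unfolding set_lebesgue_integral_def
  proof (rule integral_cong_AE)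
    show "AE v in lborel. indicator {-1..1} v *\<^sub>R (v ^ n * neg v) = v ^ n * indicator {-1..0} v"
      using AE_lborel_singleton[of 0] by eventually_elim (auto simp: indicator_def)
  qed auto
  also have "\<dots> = 0 ^ Suc n / real (Suc n) - (-1) ^ Suc n / real (Suc n)"
    by (rule integral_FTC_Icc_real[where F = "\<lambda>v. v ^ Suc n / real (Suc n)", THEN trans])
       (auto intro!: derivative_eq_intros continuous_intros simp del: power_Suc of_nat_Suc)
  finally show ?thesis by simp
qed

lemma avg_neg: "avg (\<lambda>v. v * neg v) = - 1 / 4"
  using integral_power_neg[of 1] by (simp add: avg_def)

lemma avg_sq_neg: "avg (\<lambda>v. v\<^sup>2 * neg v) = 1 / 6"
  using integral_power_neg[of 2] by (simp add: avg_def)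

lemma set_integrable_bounded_mult:
  fixes m f :: "real \<Rightarrow> real"
  assumes f: "set_integrable lborel {-1..1} f" and m: "m \<in> borel_measurable borel"
    and le: "\<And>v. v \<in> {-1..1} \<Longrightarrow> \<bar>m v\<bar> \<le> 1"
  shows "set_integrable lborel {-1..1} (\<lambda>v. m v * f v)"
  unfolding set_integrable_def
proof (rule Bochner_Integration.integrable_bound)
  show "integrable lborel (\<lambda>v. indicator {-1..1} v *\<^sub>R f v)"
    using f by (simp add: set_integrable_def)
  have "(\<lambda>v. m v * (indicator {-1..1} v *\<^sub>R f v)) \<in> borel_measurable lborel"
    using f m unfolding set_integrable_def by (intro borel_measurable_times) auto
  thus "(\<lambda>v. indicator {-1..1} v *\<^sub>R (m v * f v)) \<in> borel_measurable lborel"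
    by (simp add: mult_ac)
  show "AE v in lborel. norm (indicator {-1..1} v *\<^sub>R (m v * f v))
          \<le> norm (indicator {-1..1} v *\<^sub>R f v)"
    using le by (auto simp: indicator_def abs_mult intro!: mult_left_le_one_le)
qed

text \<open>The weight \<open>m\<close> is \<open>1\<close> for the density and \<open>v neg v\<close> for the outgoing flux of \<open>f1\<close>;
  both are bounded by \<open>1\<close>, so the error of the weighted average is at most the error in mean.\<close>

lemma converges_in_mean_avg_mult:
  assumes conv: "converges_in_mean F f g" and m: "m \<in> borel_measurable borel"
    and le: "\<And>v. v \<in> {-1..1} \<Longrightarrow> \<bar>m v\<bar> \<le> 1"
  shows "((\<lambda>p. avg (\<lambda>v. m v * f p v)) \<longlongrightarrow> avg (\<lambda>v. m v * g v)) F"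
proof -
  have g: "set_integrable lborel {-1..1} g"
    and ev: "\<forall>\<^sub>F p in F. set_integrable lborel {-1..1} (f p)"
    and lim: "((\<lambda>p. avg (\<lambda>v. \<bar>f p v - g v\<bar>)) \<longlongrightarrow> 0) F"
    using conv by (auto simp: converges_in_mean_def)
  have bound: "\<forall>\<^sub>F p in F. norm (avg (\<lambda>v. m v * f p v) - avg (\<lambda>v. m v * g v))
                  \<le> avg (\<lambda>v. \<bar>f p v - g v\<bar>)"
    using ev
  proof eventually_elim
    case (elim p)
    note mi = set_integrable_bounded_mult[OF _ m le]
    have d: "set_integrable lborel {-1..1} (\<lambda>v. f p v - g v)"
      using elim g by (rule set_integral_diff)
    have "avg (\<lambda>v. m v * f p v) - avg (\<lambda>v. m v * g v)
            = (LINT v:{-1..1}|lborel. m v * (f p v - g v)) / 2"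
      using set_integral_diff(2)[OF mi[OF elim] mi[OF g]]
      by (simp add: avg_def right_diff_distrib)
    moreover have "\<bar>LINT v:{-1..1}|lborel. m v * (f p v - g v)\<bar>
            \<le> (LINT v:{-1..1}|lborel. \<bar>m v * (f p v - g v)\<bar>)"
      using set_integral_norm_bound[OF mi[OF d]] by simp
    moreover have "\<dots> \<le> (LINT v:{-1..1}|lborel. \<bar>f p v - g v\<bar>)"
      using set_integrable_abs[OF mi[OF d]] set_integrable_abs[OF d]
      by (rule set_integral_mono) (use le in \<open>auto simp: abs_mult intro!: mult_left_le_one_le\<close>)
    ultimately show ?case by (simp add: avg_def flip: diff_divide_distrib)
  qed
  have "((\<lambda>p. avg (\<lambda>v. m v * f p v) - avg (\<lambda>v. m v * g v)) \<longlongrightarrow> 0) F"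
    by (rule Lim_null_comparison[OF bound lim])
  thus ?thesis by (simp add: LIM_zero_iff)
qed

lemma converges_in_mean_avg:
  assumes "converges_in_mean F f g"
  shows "((\<lambda>p. avg (f p)) \<longlongrightarrow> avg g) F"
  using converges_in_mean_avg_mult[OF assms, of "\<lambda>_. 1"] by simp

lemma converges_in_mean_outgoing:
  assumes "converges_in_mean F f g"
  shows "((\<lambda>p. avg (\<lambda>v. v * f p v * neg v)) \<longlongrightarrow> avg (\<lambda>v. v * g v * neg v)) F"
  using converges_in_mean_avg_mult[OF assms, of "\<lambda>v. v * neg v"]
  by (simp add: mult_ac abs_mult indicator_def)

lemma set_integrable_outgoing:
  fixes f :: "real \<Rightarrow> real"
  assumes "set_integrable lborel {-1..1} f"
  shows "set_integrable lborel {-1..1} (\<lambda>v. v * f v * neg v)"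
  using set_integrable_bounded_mult[OF assms, of "\<lambda>v. v * neg v"]
  by (simp add: mult_ac abs_mult indicator_def)

lemma avg_add:
  assumes "set_integrable lborel {-1..1} f" "set_integrable lborel {-1..1} g"
  shows "avg (\<lambda>v. f v + g v) = avg f + avg g"
  using set_integral_add(2)[OF assms] by (simp add: avg_def algebra_simps)

section \<open>The boundary value and the macroscopic flux in closed form\<close>

lemma avg_blend:
  assumes fL: "set_integrable lborel {0<..1} (\<lambda>v. v * fL v)"
    and WfL: "set_integrable lborel {0<..1} (\<lambda>v. W v * fL v)"
  shows "avg (\<lambda>v. (p * v + q * W v) * fL v * pos v)
       = p * avg (\<lambda>v. v * fL v * pos v) + q * avg (\<lambda>v. W v * fL v * pos v)"
proof -
  have "(LINT v:{0<..1}|lborel. (p * v + q * W v) * fL v)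
      = (LINT v:{0<..1}|lborel. p * (v * fL v) + q * (W v * fL v))"
    by (simp add: algebra_simps)
  also have "\<dots> = p * (LINT v:{0<..1}|lborel. v * fL v) + q * (LINT v:{0<..1}|lborel. W v * fL v)"
    using fL WfL by (subst set_integral_add(2)) auto
  finally show ?thesis by (simp add: avg_indicator_Ioc add_divide_distrib)
qed

lemma rho_left_eq:
  assumes "set_integrable lborel {0<..1} (\<lambda>v. v * fL v)"
    and "set_integrable lborel {0<..1} (\<lambda>v. W v * fL v)"
  shows "rho_left W fL dt e s a
       = (1 - theta dt (ugks_nu e s a)) * (2 * avg (\<lambda>v. v * fL v * pos v))
       + theta dt (ugks_nu e s a) * dirichlet_value W fL"
  unfolding rho_left_def Let_def avg_blend[OF assms] dirichlet_value_def
  by (simp add: algebra_simps)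

text \<open>The coefficient \<open>1/e - C\<close> of the Dirichlet value collects the incoming contribution
  \<open>\<theta>/(4e)\<close>, where \<open>1/4\<close> comes from the weight \<open>-2 \<langle>w neg w\<rangle> = 1/2\<close>, and the outgoing
  contribution \<open>\<langle>v neg v\<rangle> C \<theta> = - C \<theta> / 4\<close> of the boundary value.\<close>

lemma macro_flux_left_eq:
  assumes "set_integrable lborel {0<..1} (\<lambda>v. v * fL v)"
    and "set_integrable lborel {0<..1} (\<lambda>v. W v * fL v)"
  defines "J \<equiv> avg (\<lambda>v. v * fL v * pos v)"
  shows "macro_flux_left W fL dt dx e s a G f1
       = (1 - theta dt (ugks_nu e s a)) * (1 / e - ugks_C dt e s a / 2) * J
       + theta dt (ugks_nu e s a) * (1 / e - ugks_C dt e s a) / 4 * dirichlet_value W fL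
       + ugks_A dt e s a * avg (\<lambda>v. v * f1 v * neg v)
       + ugks_D dt e s a / 6 * right_slope dx (avg f1) (rho_left W fL dt e s a)
       - ugks_E dt e s a / 4 * G"
  unfolding macro_flux_left_def Let_def avg_blend[OF assms(1,2)] rho_left_eq[OF assms(1,2)]
    avg_neg avg_sq_neg J_def[symmetric] dirichlet_value_def
  by (simp add: algebra_simps add_divide_distrib diff_divide_distrib)

section \<open>The coefficients in the diffusion limit\<close>

context
  fixes dt s a :: real
  assumes dt: "dt > 0" and s: "s > 0"
begin

lemma theta_diffusion: "((\<lambda>e. theta dt (ugks_nu e s a)) \<longlongrightarrow> 1) (at_right 0)"
  unfolding theta_def ugks_nu_def using dt s by real_asymp

lemma A_diffusion: "((\<lambda>e. ugks_A dt e s a) \<longlongrightarrow> 0) (at_right 0)"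
  unfolding ugks_A_def ugks_nu_def Let_def using dt s by real_asymp

lemma D_diffusion: "((\<lambda>e. ugks_D dt e s a) \<longlongrightarrow> - 1 / s) (at_right 0)"
  unfolding ugks_D_def ugks_nu_def Let_def
  using dt s by (real_asymp simp: field_simps power2_eq_square)

lemma E_diffusion: "((\<lambda>e. ugks_E dt e s a) \<longlongrightarrow> 0) (at_right 0)"
  unfolding ugks_E_def ugks_nu_def Let_def using dt s by real_asymp

text \<open>Substituting \<open>\<sigma> = e\<^sup>2 (\<nu> - \<alpha>)\<close> in \<open>C\<close> removes the singular part exactly:
  \<open>1/e - C = \<alpha> / (e \<nu>) + (1 - \<alpha>/\<nu>) A\<close>, and every term on the right vanishes in the limit.\<close>

lemma C_gap_diffusion: "((\<lambda>e. 1 / e - ugks_C dt e s a) \<longlongrightarrow> 0) (at_right 0)"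
proof -
  have inv: "((\<lambda>e. 1 / ugks_nu e s a) \<longlongrightarrow> 0) (at_right 0)"
    "((\<lambda>e. 1 / (e * ugks_nu e s a)) \<longlongrightarrow> 0) (at_right 0)"
    unfolding ugks_nu_def using s by real_asymp+
  have "((\<lambda>e. a * (1 / (e * ugks_nu e s a)) + (1 - a * (1 / ugks_nu e s a)) * ugks_A dt e s a)
          \<longlongrightarrow> a * 0 + (1 - a * 0) * 0) (at_right 0)"
    by (intro tendsto_intros inv A_diffusion)
  moreover have "\<forall>\<^sub>F e in at_right 0.
      a * (1 / (e * ugks_nu e s a)) + (1 - a * (1 / ugks_nu e s a)) * ugks_A dt e s a
        = 1 / e - ugks_C dt e s a"
  proof -
    have "\<forall>\<^sub>F e in at_right 0. ugks_nu e s a > 0"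
      unfolding ugks_nu_def using s by real_asymp
    thus ?thesis using eventually_at_right_less[of 0]
    proof eventually_elim
      case (elim e)
      have se: "s = e\<^sup>2 * (ugks_nu e s a - a)"
        using elim by (simp add: ugks_nu_def field_simps)
      define n where "n = ugks_nu e s a"
      have C: "ugks_C dt e s a
          = e\<^sup>2 * (n - a) / (dt * e ^ 3 * n) * (dt - 1 / n * (1 - exp (- n * dt)))"
        unfolding ugks_C_def Let_def n_def[symmetric] using se n_def by simp
      have "n > 0" using elim by (simp add: n_def)
      thus ?case unfolding C using elim dt
        unfolding ugks_A_def Let_def n_def[symmetric]
        by (simp add: field_simps power2_eq_square power3_eq_cube)
    qed
  qed
  ultimately show ?thesis by (auto intro: Lim_transform_eventually)
qed

lemma one_minus_theta_diffusion:
  "((\<lambda>e. (1 - theta dt (ugks_nu e s a)) / e) \<longlongrightarrow> 0) (at_right 0)"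
  unfolding theta_def ugks_nu_def using dt s by real_asymp

end

section \<open>The coefficients in the free transport regime\<close>

text \<open>The next three limits are Taylor expansions at \<open>\<nu> = 0\<close>: the numerators are, in this order,
  \<open>\<nu> \<Delta>t\<close>, \<open>\<nu> \<Delta>t\<^sup>2 / 2\<close> and \<open>\<nu>\<^sup>2 \<Delta>t\<^sup>3 / 6\<close> to leading order, the last because the terms of orders
  \<open>0\<close> and \<open>1\<close> cancel.\<close>

lemma first_order_ratio:
  fixes dt :: real
  assumes "dt > 0"
  shows "((\<lambda>nu. 1 / (dt * nu) * (1 - exp (- nu * dt))) \<longlongrightarrow> 1) (at_right 0)"
  using assms by (real_asymp simp: field_simps)

lemma second_order_ratio:
  fixes dt :: real
  assumes "dt > 0"
  shows "((\<lambda>nu. 1 / (dt * nu) * (dt - 1 / nu * (1 - exp (- nu * dt)))) \<longlongrightarrow> dt / 2) (at_right 0)"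
  using assms by (real_asymp simp: field_simps power2_eq_square)

lemma third_order_ratio:
  fixes dt :: real
  assumes "dt > 0"
  shows "((\<lambda>nu. 1 / (dt * nu\<^sup>2) * (dt * (1 + exp (- nu * dt)) - 2 / nu * (1 - exp (- nu * dt))))
           \<longlongrightarrow> dt\<^sup>2 / 6) (at_right 0)"
  using assms by (real_asymp simp: field_simps power2_eq_square power3_eq_cube)

context
  fixes dt e :: real and F :: "'p filter" and s a :: "'p \<Rightarrow> real"
  assumes dt: "dt > 0" and e: "e > 0"
    and s: "(s \<longlongrightarrow> 0) F" and a: "(a \<longlongrightarrow> 0) F"
    and nonneg: "\<forall>\<^sub>F p in F. s p \<ge> 0 \<and> a p \<ge> 0 \<and> (s p, a p) \<noteq> (0, 0)"
begin

text \<open>Nonnegativity and \<open>(\<sigma>, \<alpha>) \<noteq> (0, 0)\<close> keep \<open>\<nu>\<close> positive, away from the point \<open>\<nu> = 0\<close> at which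
  division by zero would make the coefficients meaningless.\<close>

lemma nu_transport: "filterlim (\<lambda>p. ugks_nu e (s p) (a p)) (at_right 0) F"
  unfolding filterlim_at
proof
  show "((\<lambda>p. ugks_nu e (s p) (a p)) \<longlongrightarrow> 0) F"
    unfolding ugks_nu_def using tendsto_add[OF tendsto_divide[OF s tendsto_const[of "e\<^sup>2"]] a] e by simp
  show "\<forall>\<^sub>F p in F. ugks_nu e (s p) (a p) \<in> {0<..} \<and> ugks_nu e (s p) (a p) \<noteq> 0"
    using nonneg
  proof eventually_elim
    case (elim p)
    hence "0 < s p / e\<^sup>2 \<or> 0 < a p" "0 \<le> s p / e\<^sup>2" "0 \<le> a p"
      using e by (auto simp: less_le)
    thus ?case by (auto simp: ugks_nu_def)
  qed
qed

lemma theta_transport: "((\<lambda>p. theta dt (ugks_nu e (s p) (a p))) \<longlongrightarrow> 0) F"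
proof -
  have "((\<lambda>nu. theta dt nu) \<longlongrightarrow> 0) (at_right 0)"
    unfolding theta_def using dt by real_asymp
  from filterlim_compose[OF this nu_transport] show ?thesis .
qed

lemma A_transport: "((\<lambda>p. ugks_A dt e (s p) (a p)) \<longlongrightarrow> 1 / e) F"
proof -
  have "((\<lambda>p. 1 / e * (1 / (dt * ugks_nu e (s p) (a p)) * (1 - exp (- ugks_nu e (s p) (a p) * dt))))
          \<longlongrightarrow> 1 / e * 1) F"
    by (intro tendsto_mult tendsto_const filterlim_compose[OF first_order_ratio[OF dt] nu_transport])
  thus ?thesis by (simp add: ugks_A_def Let_def mult_ac)
qed

lemma E_transport: "((\<lambda>p. ugks_E dt e (s p) (a p)) \<longlongrightarrow> 1 / e * (dt / 2)) F"
proof -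
  have "((\<lambda>p. 1 / e * (1 / (dt * ugks_nu e (s p) (a p))
            * (dt - 1 / ugks_nu e (s p) (a p) * (1 - exp (- ugks_nu e (s p) (a p) * dt)))))
          \<longlongrightarrow> 1 / e * (dt / 2)) F"
    by (intro tendsto_mult tendsto_const filterlim_compose[OF second_order_ratio[OF dt] nu_transport])
  thus ?thesis by (simp add: ugks_E_def Let_def mult_ac)
qed

lemma C_transport: "((\<lambda>p. ugks_C dt e (s p) (a p)) \<longlongrightarrow> 0) F"
proof -
  have "((\<lambda>p. s p / e\<^sup>2 * ugks_E dt e (s p) (a p)) \<longlongrightarrow> 0 / e\<^sup>2 * (1 / e * (dt / 2))) F"
    using e by (intro tendsto_mult tendsto_divide tendsto_const s E_transport) auto
  \<comment> \<open>\<open>C\<close> is \<open>\<sigma>/e\<^sup>2\<close> times \<open>E\<close>\<close>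
  thus ?thesis by (simp add: ugks_C_def ugks_E_def Let_def power2_eq_square power3_eq_cube mult_ac)
qed

lemma D_transport: "((\<lambda>p. ugks_D dt e (s p) (a p)) \<longlongrightarrow> 0) F"
proof -
  have "((\<lambda>p. - (s p / e ^ 4) * (1 / (dt * (ugks_nu e (s p) (a p))\<^sup>2)
            * (dt * (1 + exp (- ugks_nu e (s p) (a p) * dt))
               - 2 / ugks_nu e (s p) (a p) * (1 - exp (- ugks_nu e (s p) (a p) * dt)))))
          \<longlongrightarrow> - (0 / e ^ 4) * (dt\<^sup>2 / 6)) F"
    using e by (intro tendsto_mult tendsto_minus tendsto_divide tendsto_const s
        filterlim_compose[OF third_order_ratio[OF dt] nu_transport]) auto
  thus ?thesis by (simp add: ugks_D_def Let_def mult_ac)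
qed

end

theorem mainTheorem7:
  fixes W fL :: "real \<Rightarrow> real" and dt dx :: real
  assumes dt: "dt > 0" and dx: "dx > 0"
    and fL: "set_integrable lborel {0<..1} (\<lambda>v. v * fL v)"
    and WfL: "set_integrable lborel {0<..1} (\<lambda>v. W v * fL v)"
  shows
    \<comment> \<open>(a) diffusion limit\<close>
    "(\<forall>(s::real) (a::real) (G::real) (f1 :: real \<Rightarrow> real \<Rightarrow> real) (f1lim :: real \<Rightarrow> real).
        s > 0 \<and> a \<ge> 0 \<and> converges_in_mean (at_right 0) f1 f1lim \<longrightarrow>
          ((\<lambda>e. theta dt (ugks_nu e s a)) \<longlongrightarrow> 1) (at_right 0) \<and>
          ((\<lambda>e. rho_left W fL dt e s a) \<longlongrightarrow> dirichlet_value W fL) (at_right 0) \<and>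
          ((\<lambda>e. macro_flux_left W fL dt dx e s a G (f1 e))
             \<longlongrightarrow> - (1 / (3 * s)) * ((avg f1lim - dirichlet_value W fL) / dx)) (at_right 0) \<and>
          (\<forall>(a1::real) (G1::real) (r' :: real \<Rightarrow> real) (\<Phi>r :: real \<Rightarrow> real) (\<Phi>rlim::real).
             a1 \<ge> 0 \<and> (\<Phi>r \<longlongrightarrow> \<Phi>rlim) (at_right 0) \<and>
             (\<forall>\<^sub>F e in at_right 0.
                first_cell_law dt dx a1 G1 (avg (f1 e)) (r' e)
                  (macro_flux_left W fL dt dx e s a G (f1 e)) (\<Phi>r e)) \<longrightarrow>
             (\<exists>r'lim. (r' \<longlongrightarrow> r'lim) (at_right 0) \<and>
                first_cell_law dt dx a1 G1 (avg f1lim) r'lim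
                  (- (1 / (3 * s)) * ((avg f1lim - dirichlet_value W fL) / dx)) \<Phi>rlim)))
     \<and>
     \<comment> \<open>(b) free transport regime\<close>
     (\<forall>(e::real) (F :: 'p filter) (s :: 'p \<Rightarrow> real) (a :: 'p \<Rightarrow> real) (G :: 'p \<Rightarrow> real)
        (f1 :: 'p \<Rightarrow> real \<Rightarrow> real) (f1lim :: real \<Rightarrow> real).
        e > 0 \<and> (s \<longlongrightarrow> 0) F \<and> (a \<longlongrightarrow> 0) F \<and> (G \<longlongrightarrow> 0) F \<and>
        (\<forall>\<^sub>F p in F. s p \<ge> 0 \<and> a p \<ge> 0 \<and> (s p, a p) \<noteq> (0, 0)) \<and>
        converges_in_mean F f1 f1lim \<and>
        (\<forall>v\<in>{-1..1}. ((\<lambda>p. f1 p v) \<longlongrightarrow> f1lim v) F) \<longrightarrow>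
          ((\<lambda>p. theta dt (ugks_nu e (s p) (a p))) \<longlongrightarrow> 0) F \<and>
          (\<forall>v\<in>{-1..1}.
             ((\<lambda>p. micro_flux_left W fL dt dx e (s p) (a p) (G p) (f1 p) v)
                \<longlongrightarrow> v / e * (fL v * pos v + f1lim v * neg v)) F) \<and>
          ((\<lambda>p. macro_flux_left W fL dt dx e (s p) (a p) (G p) (f1 p))
             \<longlongrightarrow> 1 / e * avg (\<lambda>v. v * fL v * pos v + v * f1lim v * neg v)) F)"
proof (intro conjI allI impI ballI)
  note closed = rho_left_eq[OF fL WfL] macro_flux_left_eq[OF fL WfL]
  define J where "J = avg (\<lambda>v. v * fL v * pos v)"
  define K where "K = dirichlet_value W fL"
  {
    fix s a G :: real and f1 :: "real \<Rightarrow> real \<Rightarrow> real" and f1lim :: "real \<Rightarrow> real"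
    assume A: "s > 0 \<and> a \<ge> 0 \<and> converges_in_mean (at_right 0) f1 f1lim"
    hence s: "s > 0" and conv: "converges_in_mean (at_right 0) f1 f1lim" by auto
    show th: "((\<lambda>e. theta dt (ugks_nu e s a)) \<longlongrightarrow> 1) (at_right 0)"
      by (rule theta_diffusion[OF dt s])
    have "((\<lambda>e. (1 - theta dt (ugks_nu e s a)) * (2 * J) + theta dt (ugks_nu e s a) * K)
            \<longlongrightarrow> (1 - 1) * (2 * J) + 1 * K) (at_right 0)"
      by (intro tendsto_intros th)
    thus rho: "((\<lambda>e. rho_left W fL dt e s a) \<longlongrightarrow> dirichlet_value W fL) (at_right 0)"
      by (simp add: closed J_def K_def)
    have slope: "((\<lambda>e. right_slope dx (avg (f1 e)) (rho_left W fL dt e s a))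
            \<longlongrightarrow> (avg f1lim - K) / (dx / 2)) (at_right 0)"
      unfolding right_slope_def K_def using dx
      by (intro tendsto_intros rho converges_in_mean_avg[OF conv]) auto
    \<comment> \<open>\<open>(1-\<theta>) (1/e - C/2)\<close> is split so that the divergent \<open>1/e\<close> occurs only in
      \<open>(1-\<theta>)/e\<close> and in the gap \<open>1/e - C\<close>, both of which vanish\<close>
    have "((\<lambda>e. (1 - theta dt (ugks_nu e s a)) / e * (J / 2)
             + (1 - theta dt (ugks_nu e s a)) * (1 / e - ugks_C dt e s a) * (J / 2)
             + theta dt (ugks_nu e s a) * (1 / e - ugks_C dt e s a) / 4 * K
             + ugks_A dt e s a * avg (\<lambda>v. v * f1 e v * neg v)
             + ugks_D dt e s a / 6 * right_slope dx (avg (f1 e)) (rho_left W fL dt e s a)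
             - ugks_E dt e s a / 4 * G)
           \<longlongrightarrow> 0 * (J / 2) + (1 - 1) * 0 * (J / 2) + 1 * 0 / 4 * K
             + 0 * avg (\<lambda>v. v * f1lim v * neg v)
             + (- 1 / s) / 6 * ((avg f1lim - K) / (dx / 2)) - 0 / 4 * G) (at_right 0)"
      by (intro tendsto_add tendsto_diff tendsto_mult tendsto_divide tendsto_const th slope
          one_minus_theta_diffusion[OF dt s] C_gap_diffusion[OF dt s] A_diffusion[OF dt s]
          D_diffusion[OF dt s] E_diffusion[OF dt s] converges_in_mean_outgoing[OF conv]) auto
    also have "(\<lambda>e. (1 - theta dt (ugks_nu e s a)) / e * (J / 2)
             + (1 - theta dt (ugks_nu e s a)) * (1 / e - ugks_C dt e s a) * (J / 2)
             + theta dt (ugks_nu e s a) * (1 / e - ugks_C dt e s a) / 4 * K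
             + ugks_A dt e s a * avg (\<lambda>v. v * f1 e v * neg v)
             + ugks_D dt e s a / 6 * right_slope dx (avg (f1 e)) (rho_left W fL dt e s a)
             - ugks_E dt e s a / 4 * G) = (\<lambda>e. macro_flux_left W fL dt dx e s a G (f1 e))"
      unfolding closed(2) J_def[symmetric] K_def[symmetric]
      by (intro ext) (simp add: algebra_simps add_divide_distrib diff_divide_distrib)
    also have "0 * (J / 2) + (1 - 1) * 0 * (J / 2) + 1 * 0 / 4 * K
             + 0 * avg (\<lambda>v. v * f1lim v * neg v)
             + (- 1 / s) / 6 * ((avg f1lim - K) / (dx / 2)) - 0 / 4 * G
           = - (1 / (3 * s)) * ((avg f1lim - dirichlet_value W fL) / dx)"
      using s dx by (simp add: K_def field_simps)
    finally show flux: "((\<lambda>e. macro_flux_left W fL dt dx e s a G (f1 e))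
        \<longlongrightarrow> - (1 / (3 * s)) * ((avg f1lim - dirichlet_value W fL) / dx)) (at_right 0)" .
    fix a1 G1 :: real and r' \<Phi>r :: "real \<Rightarrow> real" and \<Phi>rlim :: real
    assume B: "a1 \<ge> 0 \<and> (\<Phi>r \<longlongrightarrow> \<Phi>rlim) (at_right 0) \<and>
       (\<forall>\<^sub>F e in at_right 0. first_cell_law dt dx a1 G1 (avg (f1 e)) (r' e)
          (macro_flux_left W fL dt dx e s a G (f1 e)) (\<Phi>r e))"
    have pos: "1 / dt + a1 > 0" using dt B by (simp add: add_pos_nonneg)
    \<comment> \<open>the absorption term is implicit, so the law is a linear equation for the new density\<close>
    have law: "first_cell_law dt dx a1 G1 r q \<Phi>l \<Phi>
        \<longleftrightarrow> q = (r / dt + G1 - 1 / dx * (\<Phi> - \<Phi>l)) / (1 / dt + a1)" for r q \<Phi>l \<Phi>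
    proof -
      have "q = (r / dt + G1 - 1 / dx * (\<Phi> - \<Phi>l)) / (1 / dt + a1)
          \<longleftrightarrow> q * (1 / dt + a1) = r / dt + G1 - 1 / dx * (\<Phi> - \<Phi>l)"
        using pos by (simp add: eq_divide_eq)
      thus ?thesis unfolding first_cell_law_def by (auto simp: algebra_simps diff_divide_distrib)
    qed
    let ?\<Phi> = "- (1 / (3 * s)) * ((avg f1lim - dirichlet_value W fL) / dx)"
    have "((\<lambda>e. (avg (f1 e) / dt + G1 - 1 / dx * (\<Phi>r e - macro_flux_left W fL dt dx e s a G (f1 e)))
              / (1 / dt + a1))
        \<longlongrightarrow> (avg f1lim / dt + G1 - 1 / dx * (\<Phi>rlim - ?\<Phi>)) / (1 / dt + a1)) (at_right 0)"
      using B dt pos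
      by (intro tendsto_divide tendsto_diff tendsto_add tendsto_mult tendsto_const flux
          converges_in_mean_avg[OF conv]) auto
    moreover have "\<forall>\<^sub>F e in at_right 0.
        (avg (f1 e) / dt + G1 - 1 / dx * (\<Phi>r e - macro_flux_left W fL dt dx e s a G (f1 e)))
              / (1 / dt + a1) = r' e"
      using B by (auto simp: law elim: eventually_mono)
    ultimately have "(r' \<longlongrightarrow> (avg f1lim / dt + G1 - 1 / dx * (\<Phi>rlim - ?\<Phi>)) / (1 / dt + a1))
        (at_right 0)"
      by (rule Lim_transform_eventually)
    thus "\<exists>r'lim. (r' \<longlongrightarrow> r'lim) (at_right 0) \<and>
        first_cell_law dt dx a1 G1 (avg f1lim) r'lim ?\<Phi> \<Phi>rlim"
      unfolding law by blast
  }
  {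
    fix e :: real and F :: "'p filter" and s a G :: "'p \<Rightarrow> real"
      and f1 :: "'p \<Rightarrow> real \<Rightarrow> real" and f1lim :: "real \<Rightarrow> real"
    assume A: "e > 0 \<and> (s \<longlongrightarrow> 0) F \<and> (a \<longlongrightarrow> 0) F \<and> (G \<longlongrightarrow> 0) F \<and>
        (\<forall>\<^sub>F p in F. s p \<ge> 0 \<and> a p \<ge> 0 \<and> (s p, a p) \<noteq> (0, 0)) \<and>
        converges_in_mean F f1 f1lim \<and>
        (\<forall>v\<in>{-1..1}. ((\<lambda>p. f1 p v) \<longlongrightarrow> f1lim v) F)"
    hence e: "e > 0" and G: "(G \<longlongrightarrow> 0) F" and conv: "converges_in_mean F f1 f1lim" by auto
    have coeff: "e > 0" "(s \<longlongrightarrow> 0) F" "(a \<longlongrightarrow> 0) F"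
      "\<forall>\<^sub>F p in F. s p \<ge> 0 \<and> a p \<ge> 0 \<and> (s p, a p) \<noteq> (0, 0)" using A by auto
    note [tendsto_intros] = theta_transport[OF dt coeff] A_transport[OF dt coeff]
      C_transport[OF dt coeff] D_transport[OF dt coeff] E_transport[OF dt coeff]
    show "((\<lambda>p. theta dt (ugks_nu e (s p) (a p))) \<longlongrightarrow> 0) F"
      by (intro tendsto_intros)
    have rho: "((\<lambda>p. rho_left W fL dt e (s p) (a p)) \<longlongrightarrow> (1 - 0) * (2 * J) + 0 * K) F"
      unfolding closed J_def K_def by (intro tendsto_intros)
    have slope: "((\<lambda>p. right_slope dx (avg (f1 p)) (rho_left W fL dt e (s p) (a p)))
        \<longlongrightarrow> (avg f1lim - ((1 - 0) * (2 * J) + 0 * K)) / (dx / 2)) F"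
      unfolding right_slope_def using dx
      by (intro tendsto_intros rho converges_in_mean_avg[OF conv]) auto
    show "((\<lambda>p. micro_flux_left W fL dt dx e (s p) (a p) (G p) (f1 p) v)
        \<longlongrightarrow> v / e * (fL v * pos v + f1lim v * neg v)) F" if v: "v \<in> {-1..1}" for v
    proof -
      have f1: "((\<lambda>p. f1 p v) \<longlongrightarrow> f1lim v) F" using A v by blast
      show ?thesis
        unfolding micro_flux_left_def Let_def
        by (rule tendsto_eq_intros refl f1 rho slope G)+ (simp add: algebra_simps)
    qed
    have "((\<lambda>p. macro_flux_left W fL dt dx e (s p) (a p) (G p) (f1 p))
        \<longlongrightarrow> (1 - 0) * (1 / e - 0 / 2) * J + 0 * (1 / e - 0) / 4 * K
          + 1 / e * avg (\<lambda>v. v * f1lim v * neg v)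
          + 0 / 6 * ((avg f1lim - ((1 - 0) * (2 * J) + 0 * K)) / (dx / 2))
          - 1 / e * (dt / 2) / 4 * 0) F"
      unfolding closed(2) J_def[symmetric] K_def[symmetric]
      by (intro tendsto_intros slope G converges_in_mean_outgoing[OF conv]) auto
    moreover have "avg (\<lambda>v. v * fL v * pos v + v * f1lim v * neg v)
        = J + avg (\<lambda>v. v * f1lim v * neg v)"
      unfolding J_def
      by (rule avg_add[OF set_integrable_pos[OF fL] set_integrable_outgoing])
         (use conv in \<open>simp add: converges_in_mean_def\<close>)
    ultimately show "((\<lambda>p. macro_flux_left W fL dt dx e (s p) (a p) (G p) (f1 p))
        \<longlongrightarrow> 1 / e * avg (\<lambda>v. v * fL v * pos v + v * f1lim v * neg v)) F"
      by (simp add: distrib_left)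
  }
qed

end
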